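(* Let $v=pq$ where $p$ and $q$ are distinct primes, and suppose there exists a $(v,m,k,\lambda)$-SEDF with $k>1$ and $m>2$. Then: (i) $k^2(m-1)=\lambda(v-1)$ and $km<v$; (ii) $k(m-2)\equiv 0 \pmod p$ or $k(m-2)\equiv 0\pmod q$; (iii) if $p\mid k$, then $$\frac{p}{q}\le \frac{v}{5(v-1)}=\frac15+\frac{1}{5(v-1)},$$ and likewise with the roles of $p$ and $q$ interchanged.
   Context: Let $v,m,k,\lambda$ be positive integers with $k^2(m-1)=\lambda(v-1)$. A $(v,m,k,\lambda)$-SEDF (strong external difference family) is a collection $(D_1,\ldots,D_m)$ of pairwise disjoint subsets of some finite abelian group $G$ (written multiplicatively, with identity $1$) with $|G|=v$ and $|D_j|=k$ for all $1\le j\le m$, such that for each $1\le j\le m$ the equation $\sum_{\ell\ne j} D_j D_\ell^{-1}=\lambda(G-1)$ holds in the group algebra $\mathbb{C}[G]$. Here a subset $S\subseteq G$ is identified with the group algebra element $\sum_{g\in S} g$, and $S^{-1}$ denotes $\sum_{g\in S} g^{-1}$. *)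

theory Defs
  imports Complex_Main "HOL-Computational_Algebra.Primes" "HOL-Number_Theory.Cong"
    "HOL-Library.Disjoint_Sets" "HOL-Algebra.Module"
begin

text \<open>
  The group algebra of a finite group over the complex numbers. An element is represented by its
  coefficient function; coefficients outside the carrier are required to vanish, so that equality
  of elements is equality of functions. The product is convolution.
\<close>

definition group_algebra :: "('a, 'b) monoid_scheme \<Rightarrow> (complex, 'a \<Rightarrow> complex) module" where
  "group_algebra G =
    \<lparr> carrier = {f. \<forall>x. x \<notin> carrier G \<longrightarrow> f x = 0},
      mult = (\<lambda>f g x. if x \<in> carrier G
                then \<Sum>y\<in>carrier G. f y * g (inv\<^bsub>G\<^esub> y \<otimes>\<^bsub>G\<^esub> x) else 0),
      one = (\<lambda>x. if x = \<one>\<^bsub>G\<^esub> then 1 else 0),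
      zero = (\<lambda>x. 0),
      add = (\<lambda>f g x. f x + g x),
      smult = (\<lambda>c f x. c * f x) \<rparr>"

definition ga_basis :: "'a \<Rightarrow> 'a \<Rightarrow> complex" where
  "ga_basis g = (\<lambda>x. if x = g then 1 else 0)"

definition ga_set :: "('a, 'b) monoid_scheme \<Rightarrow> 'a set \<Rightarrow> 'a \<Rightarrow> complex" where
  "ga_set G S = (\<Oplus>\<^bsub>group_algebra G\<^esub> g \<in> S. ga_basis g)"

definition ga_set_inv :: "('a, 'b) monoid_scheme \<Rightarrow> 'a set \<Rightarrow> 'a \<Rightarrow> complex" where
  "ga_set_inv G S = (\<Oplus>\<^bsub>group_algebra G\<^esub> g \<in> S. ga_basis (inv\<^bsub>G\<^esub> g))"

definition SEDF ::
  "('a, 'b) monoid_scheme \<Rightarrow> nat \<Rightarrow> nat \<Rightarrow> nat \<Rightarrow> nat \<Rightarrow> (nat \<Rightarrow> 'a set) \<Rightarrow> bool" where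
  "SEDF G v m k lam D \<longleftrightarrow>
     v > 0 \<and> m > 0 \<and> k > 0 \<and> lam > 0 \<and> k\<^sup>2 * (m - 1) = lam * (v - 1) \<and>
     comm_group G \<and> finite (carrier G) \<and> card (carrier G) = v \<and>
     (\<forall>j\<in>{1..m}. D j \<subseteq> carrier G \<and> card (D j) = k) \<and>
     disjoint_family_on D {1..m} \<and>
     (\<forall>j\<in>{1..m}.
        (\<Oplus>\<^bsub>group_algebra G\<^esub> l \<in> {1..m} - {j}.
            ga_set G (D j) \<otimes>\<^bsub>group_algebra G\<^esub> ga_set_inv G (D l))
        = of_nat lam \<odot>\<^bsub>group_algebra G\<^esub>
            (ga_set G (carrier G) \<ominus>\<^bsub>group_algebra G\<^esub> \<one>\<^bsub>group_algebra G\<^esub>))"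

lemma group_algebra_simps:
  "carrier (group_algebra G) = {f. \<forall>x. x \<notin> carrier G \<longrightarrow> f x = 0}"
  "f \<otimes>\<^bsub>group_algebra G\<^esub> g = (\<lambda>x. if x \<in> carrier G
     then \<Sum>y\<in>carrier G. f y * g (inv\<^bsub>G\<^esub> y \<otimes>\<^bsub>G\<^esub> x) else 0)"
  "\<one>\<^bsub>group_algebra G\<^esub> = ga_basis \<one>\<^bsub>G\<^esub>"
  "\<zero>\<^bsub>group_algebra G\<^esub> = (\<lambda>x. 0)"
  "f \<oplus>\<^bsub>group_algebra G\<^esub> g = (\<lambda>x. f x + g x)"
  "c \<odot>\<^bsub>group_algebra G\<^esub> f = (\<lambda>x. c * f x)"
  by (simp_all add: group_algebra_def ga_basis_def)

lemma abelian_group_group_algebra: "abelian_group (group_algebra G)"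
proof (rule abelian_groupI)
  fix f assume "f \<in> carrier (group_algebra G)"
  then show "\<exists>g\<in>carrier (group_algebra G). g \<oplus>\<^bsub>group_algebra G\<^esub> f = \<zero>\<^bsub>group_algebra G\<^esub>"
    by (intro bexI[of _ "\<lambda>x. - f x"]) (auto simp: group_algebra_simps)
qed (auto simp: group_algebra_simps algebra_simps)

lemma group_algebra_finsum:
  assumes "\<And>i. i \<in> I \<Longrightarrow> f i \<in> carrier (group_algebra G)"
  shows "(\<Oplus>\<^bsub>group_algebra G\<^esub> i \<in> I. f i) = (\<lambda>x. \<Sum>i\<in>I. f i x)"
proof -
  interpret abelian_group "group_algebra G" by (rule abelian_group_group_algebra)
  show ?thesis using assms
    by (induction I rule: infinite_finite_induct)
      (auto simp: finsum_infinite group_algebra_simps(4,5))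
qed

lemma group_algebra_minus:
  assumes "f \<in> carrier (group_algebra G)" "g \<in> carrier (group_algebra G)"
  shows "f \<ominus>\<^bsub>group_algebra G\<^esub> g = (\<lambda>x. f x - g x)"
proof -
  interpret abelian_group "group_algebra G" by (rule abelian_group_group_algebra)
  have "\<ominus>\<^bsub>group_algebra G\<^esub> g = (\<lambda>x. - g x)"
    by (rule minus_equality) (use assms in \<open>auto simp: group_algebra_simps\<close>)
  then show ?thesis by (simp add: a_minus_def group_algebra_simps)
qed

lemma ga_set_eq:
  assumes "S \<subseteq> carrier G" "finite S"
  shows "ga_set G S = (\<lambda>x. if x \<in> S then 1 else 0)"
  unfolding ga_set_def using assms
  by (subst group_algebra_finsum) (auto simp: group_algebra_simps ga_basis_def fun_eq_iff)

lemma ring_group_algebra: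
  assumes "group G" "finite (carrier G)"
  shows "ring (group_algebra G)"
proof -
  interpret group G by fact
  have bij: "(\<Sum>y\<in>carrier G. h (z \<otimes>\<^bsub>G\<^esub> y)) = (\<Sum>y\<in>carrier G. h y)"
    if "z \<in> carrier G" for z and h :: "'a \<Rightarrow> complex"
    by (rule sum.reindex_bij_witness[of _ "\<lambda>y. inv\<^bsub>G\<^esub> z \<otimes>\<^bsub>G\<^esub> y" "\<lambda>y. z \<otimes>\<^bsub>G\<^esub> y"])
      (use that in \<open>auto simp: m_assoc[symmetric]\<close>)
  have mon: "monoid (group_algebra G)"
  proof (rule monoidI, goal_cases)
    case (3 f g h)
    have "(\<Sum>y\<in>carrier G. (\<Sum>z\<in>carrier G. f z * g (inv\<^bsub>G\<^esub> z \<otimes>\<^bsub>G\<^esub> y)) * h (inv\<^bsub>G\<^esub> y \<otimes>\<^bsub>G\<^esub> x))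
        = (\<Sum>z\<in>carrier G. f z * (\<Sum>y\<in>carrier G. g y * h (inv\<^bsub>G\<^esub> y \<otimes>\<^bsub>G\<^esub> (inv\<^bsub>G\<^esub> z \<otimes>\<^bsub>G\<^esub> x))))"
      if x: "x \<in> carrier G" for x
    proof -
      have "(\<Sum>y\<in>carrier G. (\<Sum>z\<in>carrier G. f z * g (inv\<^bsub>G\<^esub> z \<otimes>\<^bsub>G\<^esub> y)) * h (inv\<^bsub>G\<^esub> y \<otimes>\<^bsub>G\<^esub> x))
        = (\<Sum>z\<in>carrier G. f z * (\<Sum>y\<in>carrier G. g (inv\<^bsub>G\<^esub> z \<otimes>\<^bsub>G\<^esub> y) * h (inv\<^bsub>G\<^esub> y \<otimes>\<^bsub>G\<^esub> x)))"
        unfolding sum_distrib_right sum_distrib_left by (subst sum.swap) (simp add: mult.assoc)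
      also have "\<dots> = (\<Sum>z\<in>carrier G. f z * (\<Sum>y\<in>carrier G. g y * h (inv\<^bsub>G\<^esub> y \<otimes>\<^bsub>G\<^esub> (inv\<^bsub>G\<^esub> z \<otimes>\<^bsub>G\<^esub> x))))"
      proof (rule sum.cong[OF refl], rule arg_cong2[where f="(*)", OF refl])
        fix z assume z: "z \<in> carrier G"
        have "(\<Sum>y\<in>carrier G. g (inv\<^bsub>G\<^esub> z \<otimes>\<^bsub>G\<^esub> y) * h (inv\<^bsub>G\<^esub> y \<otimes>\<^bsub>G\<^esub> x))
          = (\<Sum>y\<in>carrier G. g (inv\<^bsub>G\<^esub> z \<otimes>\<^bsub>G\<^esub> (z \<otimes>\<^bsub>G\<^esub> y)) * h (inv\<^bsub>G\<^esub> (z \<otimes>\<^bsub>G\<^esub> y) \<otimes>\<^bsub>G\<^esub> x))"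
          using bij[OF z, of "\<lambda>y. g (inv\<^bsub>G\<^esub> z \<otimes>\<^bsub>G\<^esub> y) * h (inv\<^bsub>G\<^esub> y \<otimes>\<^bsub>G\<^esub> x)"] by simp
        also have "\<dots> = (\<Sum>y\<in>carrier G. g y * h (inv\<^bsub>G\<^esub> y \<otimes>\<^bsub>G\<^esub> (inv\<^bsub>G\<^esub> z \<otimes>\<^bsub>G\<^esub> x)))"
          by (rule sum.cong) (use z x in \<open>auto simp: inv_mult_group m_assoc[symmetric]\<close>)
        finally show "(\<Sum>y\<in>carrier G. g (inv\<^bsub>G\<^esub> z \<otimes>\<^bsub>G\<^esub> y) * h (inv\<^bsub>G\<^esub> y \<otimes>\<^bsub>G\<^esub> x))
          = (\<Sum>y\<in>carrier G. g y * h (inv\<^bsub>G\<^esub> y \<otimes>\<^bsub>G\<^esub> (inv\<^bsub>G\<^esub> z \<otimes>\<^bsub>G\<^esub> x)))" .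
      qed
      finally show ?thesis .
    qed
    then show ?case by (auto simp: group_algebra_simps fun_eq_iff cong: if_cong)
  next
    case (4 f)
    have "(\<Sum>y\<in>carrier G. ga_basis \<one>\<^bsub>G\<^esub> y * f (inv\<^bsub>G\<^esub> y \<otimes>\<^bsub>G\<^esub> x)) = f x"
      if "x \<in> carrier G" for x
    proof -
      have "(\<Sum>y\<in>carrier G. ga_basis \<one>\<^bsub>G\<^esub> y * f (inv\<^bsub>G\<^esub> y \<otimes>\<^bsub>G\<^esub> x))
        = (\<Sum>y\<in>carrier G. if y = \<one>\<^bsub>G\<^esub> then f x else 0)"
        by (rule sum.cong) (use that in \<open>auto simp: ga_basis_def\<close>)
      then show ?thesis using assms by simp
    qed
    with 4 show ?case by (auto simp: group_algebra_simps fun_eq_iff)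
  next
    case (5 f)
    have "(\<Sum>y\<in>carrier G. f y * ga_basis \<one>\<^bsub>G\<^esub> (inv\<^bsub>G\<^esub> y \<otimes>\<^bsub>G\<^esub> x)) = f x"
      if x: "x \<in> carrier G" for x
    proof -
      have "inv\<^bsub>G\<^esub> y \<otimes>\<^bsub>G\<^esub> x = \<one>\<^bsub>G\<^esub> \<longleftrightarrow> y = x" if "y \<in> carrier G" for y
        using that x by (metis inv_closed inv_equality inv_inv l_inv)
      then have "(\<Sum>y\<in>carrier G. f y * ga_basis \<one>\<^bsub>G\<^esub> (inv\<^bsub>G\<^esub> y \<otimes>\<^bsub>G\<^esub> x))
        = (\<Sum>y\<in>carrier G. if y = x then f x else 0)"
        by (intro sum.cong) (auto simp: ga_basis_def)
      then show ?thesis using assms x by simp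
    qed
    with 5 show ?case by (auto simp: group_algebra_simps fun_eq_iff)
  qed (auto simp: group_algebra_simps ga_basis_def)
  show ?thesis
    by (rule ringI[OF abelian_group_group_algebra mon])
      (auto simp: group_algebra_simps fun_eq_iff algebra_simps sum.distrib)
qed

end

theory Submission
  imports Defs "HOL-Algebra.Sylow" "HOL-Algebra.Multiplicative_Group" "Jordan_Normal_Form.Char_Poly"
begin

text \<open>
  Put \<open>a\<^sub>j = \<chi>(D\<^sub>j)\<close> and \<open>A = a\<^sub>1 + \<dots> + a\<^sub>m\<close> for a nontrivial character \<open>\<chi>\<close>, so that
  \<open>a\<^sub>j\<close> times the conjugate of \<open>A - a\<^sub>j\<close> is \<open>-\<lambda>\<close>. If \<open>A \<noteq> 0\<close>, every \<open>a\<^sub>j / A\<close> is one of the two real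
  roots of \<open>x\<^sup>2 - x = \<lambda> / |A|\<^sup>2\<close>. If \<open>b\<close> of them are the larger root, then summing to 1 forces
  \<open>2 \<le> b < m / 2\<close>, and \<open>(b - 1) a\<^sub>i + (m - 1 - b) a\<^sub>j = 0\<close> whenever \<open>a\<^sub>i / A\<close> is the larger root and
  \<open>a\<^sub>j / A\<close> the smaller.

  An integer polynomial that vanishes at a nontrivial \<open>p\<close>-th root of unity has value divisible by
  \<open>p\<close> at 1. For \<open>\<chi>\<close> of order \<open>p\<close> this gives \<open>p | km\<close> (if \<open>A = 0\<close>) or \<open>p | k(m - 2)\<close> (from the
  relation), and the same holds for \<open>q\<close>; since \<open>km < pq\<close>, the first case cannot occur for both primes.
  Fourier inversion gives \<open>A \<noteq> 0\<close> for some \<open>\<chi>\<close>, hence \<open>m \<ge> 5\<close>. If \<open>p | k\<close>, then \<open>p\<^sup>2 | \<lambda>\<close>, and (iii)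
  follows from \<open>p\<^sup>2 \<le> \<lambda>\<close>, \<open>km < v\<close> and \<open>5(m - 1) \<le> m\<^sup>2\<close>.
\<close>

section \<open>Integer relations between roots of unity\<close>

text \<open>Multiplication by an integer combination of powers of \<open>\<omega>\<close> acts on
  the vector of powers \<open>\<omega> ^ 0, ..., \<omega> ^ (n - 1)\<close> by an integer matrix.
  The combination is an eigenvalue of that matrix, hence a root of a monic integer polynomial. The
  powers may repeat; it is enough that the vector is nonzero.\<close>

lemma algebraic_int_poly_root_of_unity:
  fixes \<omega> :: "'a :: field_char_0" and h :: "int poly"
  assumes "\<omega> ^ n = 1" "n > 0"
  shows "algebraic_int (poly (of_int_poly h) \<omega>)"
proof -
  define u where "u = poly (of_int_poly h) \<omega>"
  \<comment> \<open>the matrix of multiplication by \<open>u\<close> on the span of the powers of \<open>\<omega>\<close>\<close>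
  define C where "C = mat n n (\<lambda>(i, j). \<Sum>k\<le>degree h. if (i + k) mod n = j then coeff h k else 0)"
  define w where "w = vec n (\<lambda>j. \<omega> ^ j)"
  have C: "C \<in> carrier_mat n n" by (simp add: C_def)
  have w_mod: "\<omega> ^ (k mod n) = \<omega> ^ k" for k
    by (metis assms(1) mod_mult_div_eq mult.right_neutral power_add power_mult power_one)
  have "map_mat of_int C *\<^sub>v w = u \<cdot>\<^sub>v w"
  proof (rule eq_vecI)
    fix i assume "i < dim_vec (u \<cdot>\<^sub>v w)"
    then have i: "i < n" by (simp add: w_def)
    have "(map_mat of_int C *\<^sub>v w) $ i
        = (\<Sum>j<n. \<Sum>k\<le>degree h. if (i + k) mod n = j then of_int (coeff h k) * \<omega> ^ j else 0)"
      using i by (auto simp: C_def w_def scalar_prod_def sum_distrib_right atLeast0LessThan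
          intro!: sum.cong)
    also have "\<dots> = (\<Sum>k\<le>degree h. of_int (coeff h k) * \<omega> ^ (i + k))"
      using assms(2) by (subst sum.swap) (simp add: w_mod)
    also have "\<dots> = u * \<omega> ^ i"
      by (simp add: u_def poly_altdef power_add sum_distrib_left sum_distrib_right mult_ac)
    finally show "(map_mat of_int C *\<^sub>v w) $ i = (u \<cdot>\<^sub>v w) $ i"
      using i by (simp add: w_def)
  qed (simp_all add: C_def w_def)
  moreover have "w \<noteq> 0\<^sub>v n"
  proof
    assume "w = 0\<^sub>v n"
    then have "w $ 0 = 0" using assms(2) by simp
    then show False using assms(2) by (simp add: w_def)
  qed
  ultimately have "eigenvalue (map_mat of_int C) u"
    unfolding eigenvalue_def eigenvector_def using C by (intro exI[of _ w]) (auto simp: w_def)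
  then have "poly (of_int_poly (char_poly C)) u = 0"
    using eigenvalue_root_char_poly[of "map_mat of_int C" n u] C
    by (simp add: of_int_hom.char_poly_hom)
  moreover have "lead_coeff (char_poly C) = 1"
    using degree_monic_char_poly[OF C] by simp
  ultimately show ?thesis
    unfolding algebraic_int_altdef_ipoly u_def by blast
qed

text \<open>Division by \<open>x - 1\<close> leaves the remainder \<open>c = f(1)\<close>, so
  \<open>c\<close> is \<open>1 - \<omega>\<close> times an integer polynomial in
  \<open>\<omega>\<close>. The binomial theorem makes \<open>(1 - \<omega>) ^ p\<close> equal to
  \<open>p\<close> times such a polynomial, so \<open>c ^ p / p\<close> is a rational algebraic
  integer. This avoids the irreducibility of cyclotomic polynomials.\<close>

lemma prime_dvd_poly_1_if_root_of_unity_root: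
  fixes \<omega> :: "'a :: field_char_0" and f :: "int poly"
  assumes p: "prime p" and \<omega>: "\<omega> ^ p = 1" "\<omega> \<noteq> 1" and root: "poly (of_int_poly f) \<omega> = 0"
  shows "int p dvd poly f 1"
proof -
  define g where "g = synthetic_div f 1"
  define c where "c = poly f 1"
  have f: "f = [:-1, 1:] * g + [:c:]"
    using synthetic_div_correct'[of 1 f] by (simp add: g_def c_def)
  have "poly (of_int_poly f) \<omega> = (\<omega> - 1) * poly (of_int_poly g) \<omega> + of_int c"
    by (subst f) (simp add: hom_distribs algebra_simps)
  then have c: "of_int c = (1 - \<omega>) * poly (of_int_poly g) \<omega>"
    using root by (simp add: algebra_simps add_eq_0_iff)
  obtain h :: "int poly" where h: "(1 - \<omega>) ^ p = of_nat p * poly (of_int_poly h) \<omega>"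
  proof
    define e :: "nat \<Rightarrow> int" where "e k = (-1) ^ k * int ((p choose k) div p)" for k
    \<comment> \<open>The terms 0 and \<open>p\<close> of the binomial expansion together give
      \<open>1 + (-1) ^ p\<close>, which is 0 for odd \<open>p\<close> and 2 for
      \<open>p = 2\<close>, so it is divisible by \<open>p\<close> in both cases.\<close>
    define s :: int where "s = (1 + (-1) ^ p) div int p"
    have s: "int p * s = 1 + (-1) ^ p"
    proof (cases "p = 2")
      case False
      then have "odd p" using p prime_odd_nat prime_gt_1_nat
        by (metis One_nat_def Suc_leI le_neq_implies_less numeral_2_eq_2)
      then show ?thesis by (simp add: s_def)
    qed (simp add: s_def)
    have split: "{..p} = insert 0 (insert p {0<..<p})" "0 \<noteq> p"
      using prime_gt_0_nat[OF p] by auto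
    have "(1 - \<omega>) ^ p = (\<Sum>k\<le>p. of_nat (p choose k) * (- \<omega>) ^ k)"
      using binomial_ring[of "- \<omega>" 1 p] by simp
    also have "\<dots> = 1 + (- \<omega>) ^ p + (\<Sum>k\<in>{0<..<p}. of_nat (p choose k) * (- \<omega>) ^ k)"
      using split by simp
    also have "1 + (- \<omega>) ^ p = of_int (1 + (-1) ^ p)"
      using \<omega> by (simp add: power_minus[of \<omega>])
    also have "\<dots> = of_nat p * of_int s"
      by (simp flip: s)
    also have "(\<Sum>k\<in>{0<..<p}. of_nat (p choose k) * (- \<omega>) ^ k)
        = of_nat p * (\<Sum>k\<in>{0<..<p}. of_int (e k) * \<omega> ^ k)"
      unfolding sum_distrib_left
    proof (rule sum.cong[OF refl])
      fix k assume "k \<in> {0<..<p}"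
      then have "p dvd (p choose k)" using p by (intro dvd_choose_prime) auto
      then have "of_nat (p choose k) = (of_nat p * of_nat ((p choose k) div p) :: 'a)"
        by (metis dvd_mult_div_cancel of_nat_mult)
      then show "of_nat (p choose k) * (- \<omega>) ^ k = of_nat p * (of_int (e k) * \<omega> ^ k)"
        by (simp add: e_def power_minus[of \<omega>] mult_ac)
    qed
    also have "of_nat p * of_int s + \<dots>
        = of_nat p * poly (of_int_poly ([:s:] + (\<Sum>k\<in>{0<..<p}. monom (e k) k))) \<omega>"
      by (simp add: hom_distribs poly_monom poly_sum algebra_simps)
    finally show "(1 - \<omega>) ^ p
        = of_nat p * poly (of_int_poly ([:s:] + (\<Sum>k\<in>{0<..<p}. monom (e k) k))) \<omega>" .
  qed
  \<comment> \<open>\<open>c\<^sup>p / p\<close> equals \<open>u\<close>, hence is rational and an algebraic integer.\<close>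
  define u where "u = poly (of_int_poly (h * g ^ p)) \<omega>"
  have cu: "of_int (c ^ p) = of_nat p * u"
    by (simp add: c power_mult_distrib h u_def hom_distribs mult_ac)
  have p0: "p > 0" using p prime_gt_0_nat by blast
  have "algebraic_int u"
    unfolding u_def by (rule algebraic_int_poly_root_of_unity[OF \<omega>(1) p0])
  moreover have "u = of_int (c ^ p) / of_nat p"
    using p0 by (simp add: cu del: of_int_power)
  then have "u \<in> \<rat>" by simp
  ultimately have "u \<in> \<int>" by (rule rational_algebraic_int_is_int)
  then obtain z where "u = of_int z" by (auto elim: Ints_cases)
  then have "(of_int (c ^ p) :: 'a) = of_int (int p * z)" by (simp only: cu of_int_mult of_int_of_nat_eq)
  then have "c ^ p = int p * z" by (simp only: of_int_eq_iff)
  then have "int p dvd c ^ p" by simp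
  then show ?thesis
    using p prime_dvd_power_int_iff[of "int p" p c] p0 by (simp add: c_def)
qed

lemma prime_dvd_sum_if_root_of_unity_sum_eq_0:
  fixes \<omega> :: "'a :: field_char_0" and c :: "'b \<Rightarrow> int" and e :: "'b \<Rightarrow> nat"
  assumes "prime p" "\<omega> ^ p = 1" "\<omega> \<noteq> 1" "(\<Sum>i\<in>I. of_int (c i) * \<omega> ^ e i) = 0"
  shows "int p dvd (\<Sum>i\<in>I. c i)"
  using prime_dvd_poly_1_if_root_of_unity_root[OF assms(1-3), of "\<Sum>i\<in>I. monom (c i) (e i)"] assms(4)
  by (simp add: hom_distribs poly_sum poly_monom)

section \<open>Characters of cyclic groups\<close>

text \<open>Elements \<open>x\<close> and \<open>y\<close> of orders \<open>p\<close> and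
  \<open>q\<close> exist by Cauchy's theorem, obtained here from a subgroup of prime order. Both
  primes divide the order of \<open>x \<otimes> y\<close>. The group is thus cyclic, which makes its
  characters explicit.\<close>

lemma (in comm_group) element_of_order_prime_mult:
  assumes "prime p" "prime q" "p \<noteq> q" "finite (carrier G)" "Coset.order G = p * q"
  obtains a where "a \<in> carrier G" "ord a = p * q"
proof -
  have Cauchy: "\<exists>x\<in>carrier G. ord x = r" if r: "prime r" "Coset.order G = r * s" for r s
  proof -
    obtain H where H: "subgroup H G" "card H = r"
      using sylow_thm[OF r(1) is_group, of 1 s] r(2) assms(4) by auto
    interpret H: group "G\<lparr>carrier := H\<rparr>" by (rule subgroup.subgroup_is_group[OF H(1) is_group])
    have "card H > 1" using H(2) prime_gt_1_nat[OF r(1)] by simp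
    then have "\<not> H \<subseteq> {\<one>}" using card_mono[of "{\<one>}" H] by auto
    then obtain x where x: "x \<in> H" "x \<noteq> \<one>" by blast
    have "x [^] r = \<one>"
      using H.pow_order_eq_1[of x] x H by (simp add: Coset.order_def flip: nat_pow_consistent)
    moreover have xG: "x \<in> carrier G" using x H(1) by (meson subgroup.mem_carrier)
    ultimately have "ord x dvd r" by (simp add: pow_eq_id)
    moreover have "ord x \<noteq> 1" using x xG ord_eq_1 by simp
    ultimately have "ord x = r" using r(1) by (metis prime_nat_iff)
    then show ?thesis using xG by blast
  qed
  obtain x where x: "x \<in> carrier G" "ord x = p" using Cauchy assms by blast
  obtain y where y: "y \<in> carrier G" "ord y = q" using Cauchy assms by (metis mult.commute)
  have dvd: "s dvd ord (z \<otimes> w)"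
    if "z \<in> carrier G" "w \<in> carrier G" "ord z = r" "ord w = s" "prime r" "prime s" "r \<noteq> s" for z w r s
  proof -
    \<comment> \<open>This exponent kills both \<open>z \<otimes> w\<close> and \<open>z\<close>,
      hence also \<open>w\<close>.\<close>
    define n where "n = ord (z \<otimes> w) * r"
    have "(z \<otimes> w) [^] n = \<one>" "z [^] n = \<one>"
      using that(1-3) pow_eq_id[of "z \<otimes> w" n] pow_eq_id[of z n] by (auto simp: n_def)
    then have "w [^] n = \<one>"
      using that(1,2) nat_pow_distrib[of z w n] by simp
    then have "s dvd ord (z \<otimes> w) * r"
      using that(2,4) pow_eq_id[of w n] by (simp add: n_def)
    moreover have "coprime s r" using primes_coprime[OF that(6,5)] that(7) by simp
    ultimately show ?thesis by (simp add: coprime_dvd_mult_left_iff)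
  qed
  have "q dvd ord (x \<otimes> y)" using dvd[of x y] x y assms by simp
  moreover have "p dvd ord (x \<otimes> y)" using dvd[of y x] x y assms by (simp add: m_comm)
  ultimately have "p * q dvd ord (x \<otimes> y)"
    using primes_coprime[OF assms(1-3)] by (intro divides_mult)
  moreover have "ord (x \<otimes> y) dvd p * q"
    using ord_dvd_group_order[of "x \<otimes> y"] x y assms by simp
  ultimately have "ord (x \<otimes> y) = p * q" by (rule dvd_antisym[symmetric])
  then show thesis using that x y by blast
qed

lemma (in group) bij_betw_nat_pow_ord:
  assumes "finite (carrier G)" "a \<in> carrier G" "ord a = Coset.order G"
  shows "bij_betw (\<lambda>i::nat. a [^] i) {..<Coset.order G} (carrier G)"
proof -
  have pos: "Coset.order G > 0" using assms(1) order_gt_0_iff_finite by blast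
  have inj: "inj_on (\<lambda>i::nat. a [^] i) {..<Coset.order G}"
    by (rule inj_on_subset[OF ord_inj[OF assms(2)]]) (use assms(3) pos in auto)
  moreover have "(\<lambda>i::nat. a [^] i) ` {..<Coset.order G} = carrier G"
  proof (rule card_subset_eq)
    show "card ((\<lambda>i::nat. a [^] i) ` {..<Coset.order G}) = card (carrier G)"
      unfolding card_image[OF inj] by (simp add: Coset.order_def)
  qed (use assms in auto)
  ultimately show ?thesis by (simp add: bij_betw_def)
qed

text \<open>Exponents giving the same power of \<open>a\<close> differ by a multiple of the group
  order, so \<open>\<zeta> ^ i\<close> depends only on \<open>a [^] i\<close>. The arbitrary
  discrete logarithm \<open>e\<close> therefore yields a well-defined homomorphism.\<close>

lemma (in group) cyclic_character:
  fixes \<zeta> :: "'c :: field"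
  assumes "finite (carrier G)" "a \<in> carrier G" "ord a = Coset.order G" "\<zeta> ^ Coset.order G = 1"
  obtains \<chi> where "\<And>x y. x \<in> carrier G \<Longrightarrow> y \<in> carrier G \<Longrightarrow> \<chi> (x \<otimes> y) = \<chi> x * \<chi> y"
    "\<And>i::nat. \<chi> (a [^] i) = \<zeta> ^ i"
proof -
  define e where "e x = (SOME i::nat. x = a [^] i)" for x
  have e: "a [^] e x = x" if "x \<in> carrier G" for x
  proof -
    have "x \<in> (\<lambda>i::nat. a [^] i) ` {..<Coset.order G}"
      using that bij_betw_nat_pow_ord[OF assms(1-3)] by (simp add: bij_betw_def)
    then have "\<exists>i::nat. x = a [^] i" by blast
    then show ?thesis unfolding e_def by (rule someI2_ex) simp
  qed
  have \<zeta>: "\<zeta> ^ i = \<zeta> ^ j" if "a [^] i = a [^] j" for i j :: nat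
  proof -
    have *: "\<zeta> ^ j = \<zeta> ^ i" if le: "i \<le> j" and eq: "a [^] i = a [^] j" for i j :: nat
    proof -
      have "a [^] i \<otimes> a [^] (j - i) = a [^] j"
        using le assms(2) by (simp add: nat_pow_mult)
      then have "a [^] i \<otimes> a [^] (j - i) = a [^] i \<otimes> \<one>"
        using eq assms(2) by simp
      then have "a [^] (j - i) = \<one>" 
        using assms(2) Units_l_cancel[of "a [^] i" "a [^] (j - i)" \<one>] by simp
      then have "Coset.order G dvd j - i" using assms by (simp add: pow_eq_id)
      then obtain d where "j = i + Coset.order G * d" using le by (metis dvdE le_add_diff_inverse)
      then show ?thesis by (simp add: power_add power_mult assms(4))
    qed
    show ?thesis using *[of i j] *[of j i] that by (metis nle_le)
  qed
  show thesis
  proof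
    fix x y assume "x \<in> carrier G" "y \<in> carrier G"
    then show "\<zeta> ^ e (x \<otimes> y) = \<zeta> ^ e x * \<zeta> ^ e y"
      unfolding power_add[symmetric] by (intro \<zeta>) (simp add: e assms(2) flip: nat_pow_mult)
  next
    fix i :: nat show "\<zeta> ^ e (a [^] i) = \<zeta> ^ i"
      by (intro \<zeta>) (simp add: e assms(2))
  qed
qed

section \<open>Roots of unity and Fourier inversion on a finite cyclic group\<close>

lemma primitive_root_of_unity_exists:
  assumes "n > 0"
  obtains \<zeta> :: complex where "\<And>k. \<zeta> ^ k = 1 \<longleftrightarrow> n dvd k"
proof
  define \<zeta> where "\<zeta> = cis (2 * pi / n)"
  have pow: "\<zeta> ^ k = cis (2 * pi * k / n)" for k
    by (simp add: \<zeta>_def DeMoivre mult.commute)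
  have n: "\<zeta> ^ n = 1" using assms by (simp add: pow)
  show "\<zeta> ^ k = 1 \<longleftrightarrow> n dvd k" for k
  proof -
    have "\<zeta> ^ k = \<zeta> ^ (n * (k div n) + k mod n)" by simp
    also have "\<dots> = \<zeta> ^ (k mod n)" unfolding power_add power_mult n by simp
    also have "\<dots> = 1 \<longleftrightarrow> k mod n = 0"
    proof -
      have "inj_on (\<lambda>k. cis (2 * pi * real k / real n)) {..<n}"
        using bij_betw_roots_unity[OF assms] by (simp add: bij_betw_def)
      from inj_on_eq_iff[OF this, of "k mod n" 0] show ?thesis
        using assms by (simp add: pow)
    qed
    finally show ?thesis by (simp add: dvd_eq_mod_eq_0)
  qed
qed

lemma geometric_sum_root_of_unity:
  fixes x :: "'a :: field"
  assumes "x ^ n = 1" "x \<noteq> 1"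
  shows "(\<Sum>i<n. x ^ i) = 0"
  using geometric_sum[OF assms(2), of n] assms(1) by simp

text \<open>Fourier inversion: weight the coefficient at \<open>t\<close> by the inverse of
  \<open>\<zeta> ^ (t * j)\<close> and sum over \<open>t\<close>. By hypothesis only
  \<open>t = 0\<close> survives; after swapping the sums, orthogonality leaves only
  \<open>i = j\<close>.\<close>

lemma constant_if_fourier_coefficients_vanish:
  fixes a :: "nat \<Rightarrow> 'a :: field"
  assumes \<zeta>: "\<And>k. \<zeta> ^ k = 1 \<longleftrightarrow> n dvd k"
    and vanish: "\<And>t. t \<in> {1..<n} \<Longrightarrow> (\<Sum>i<n. a i * (\<zeta> ^ t) ^ i) = 0"
    and "j < n"
  shows "of_nat n * a j = (\<Sum>i<n. a i)"
proof -
  \<comment> \<open>The factor with exponent \<open>n - j\<close> is the inverse of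
    \<open>(\<zeta> ^ t) ^ j\<close>, written with a natural exponent.\<close>
  have "(\<Sum>i<n. a i) = (\<Sum>t<n. (\<zeta> ^ t) ^ (n - j) * (\<Sum>i<n. a i * (\<zeta> ^ t) ^ i))"
  proof -
    have "{..<n} = insert 0 {1..<n}" using \<open>j < n\<close> by auto
    then show ?thesis using vanish by simp
  qed
  also have "\<dots> = (\<Sum>i<n. a i * (\<Sum>t<n. (\<zeta> ^ (n - j + i)) ^ t))"
  proof -
    have "(\<zeta> ^ t) ^ (n - j) * (a i * (\<zeta> ^ t) ^ i) = a i * (\<zeta> ^ (n - j + i)) ^ t" for t i
    proof -
      have "(\<zeta> ^ (n - j + i)) ^ t = (\<zeta> ^ t) ^ (n - j + i)"
        by (simp only: mult.commute flip: power_mult)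
      then show ?thesis by (simp add: power_add mult_ac)
    qed
    then show ?thesis
      unfolding sum_distrib_left by (subst sum.swap) (simp only:)
  qed
  also have "\<dots> = (\<Sum>i<n. if i = j then of_nat n * a j else 0)"
  proof (rule sum.cong[OF refl])
    fix i assume "i \<in> {..<n}"
    then have i: "i < n" by simp
    have "(\<Sum>t<n. (\<zeta> ^ (n - j + i)) ^ t) = 0" if "i \<noteq> j"
    proof (rule geometric_sum_root_of_unity)
      show "(\<zeta> ^ (n - j + i)) ^ n = 1" using \<zeta> by (simp flip: power_mult)
      have "\<not> n dvd n - j + i"
      proof
        assume "n dvd n - j + i"
        then obtain d where d: "n - j + i = n * d" ..
        \<comment> \<open>The only multiple of \<open>n\<close> strictly between 0 and
          \<open>2 * n\<close> is \<open>n\<close> itself, which would force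
          \<open>i = j\<close>.\<close>
        have "0 < n - j + i" "n - j + i < n * 2" using i \<open>j < n\<close> that by auto
        then have "0 < n * d" "n * d < n * 2" by (simp_all only: d)
        then have "d = 1" by (cases d) auto
        then show False using d \<open>j < n\<close> that by simp
      qed
      then show "\<zeta> ^ (n - j + i) \<noteq> 1" using \<zeta> by blast
    qed
    moreover have "\<zeta> ^ n = 1" using \<zeta> by simp
    ultimately show "a i * (\<Sum>t<n. (\<zeta> ^ (n - j + i)) ^ t) = (if i = j then of_nat n * a j else 0)"
      using \<open>j < n\<close> by (auto simp: mult.commute)
  qed
  also have "\<dots> = of_nat n * a j" using \<open>j < n\<close> by simp
  finally show ?thesis ..
qed

section \<open>Character values of strong external difference families\<close>

text \<open>The linear extension \<open>X\<close> of \<open>\<chi>\<close> turns convolution into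
  multiplication, so it can be applied to the defining equation. It sends inverses to conjugates
  because \<open>\<chi>\<close> has modulus 1, and it sends \<open>G - 1\<close> to
  \<open>0 - 1\<close>.\<close>

lemma SEDF_character_sum:
  fixes G (structure)
  assumes "SEDF G v m k lam D"
    and mult: "\<And>x y. x \<in> carrier G \<Longrightarrow> y \<in> carrier G \<Longrightarrow> \<chi> (x \<otimes> y) = \<chi> x * \<chi> y"
    and norm: "\<And>x. x \<in> carrier G \<Longrightarrow> cmod (\<chi> x) = 1"
    and nontrivial: "(\<Sum>x\<in>carrier G. \<chi> x) = 0"
    and j: "j \<in> {1..m}"
  shows "(\<Sum>x\<in>D j. \<chi> x) * cnj (\<Sum>l\<in>{1..m} - {j}. \<Sum>x\<in>D l. \<chi> x) = - of_nat lam"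
proof -
  interpret comm_group G using assms(1) by (simp add: SEDF_def)
  have fin: "finite (carrier G)" using assms(1) by (simp add: SEDF_def)
  have D: "D l \<subseteq> carrier G" if "l \<in> {1..m}" for l using assms(1) that by (simp add: SEDF_def)
  have finD: "finite (D l)" if "l \<in> {1..m}" for l
    using D[OF that] fin by (rule finite_subset)
  define X where "X f = (\<Sum>x\<in>carrier G. f x * \<chi> x)" for f :: "'a \<Rightarrow> complex"
  have one: "\<chi> \<one> = 1"
    using mult[of \<one> \<one>] norm[of \<one>] by auto
  have inv: "\<chi> (inv x) = cnj (\<chi> x)" if "x \<in> carrier G" for x
  proof -
    have "\<chi> x * \<chi> (inv x) = 1" using mult[of x "inv x"] that one by simp
    moreover have "\<chi> x * cnj (\<chi> x) = 1" using norm[OF that] by (simp flip: complex_norm_square)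
    ultimately show ?thesis using norm[OF that] by (metis mult_left_cancel mult_zero_left zero_neq_one)
  qed
  have X_mult: "X (f \<otimes>\<^bsub>group_algebra G\<^esub> g) = X f * X g" for f g
  proof -
    have "X (f \<otimes>\<^bsub>group_algebra G\<^esub> g)
        = (\<Sum>y\<in>carrier G. f y * (\<Sum>x\<in>carrier G. g (inv y \<otimes> x) * \<chi> x))"
      unfolding X_def group_algebra_simps sum_distrib_left
      by (subst sum.swap) (auto simp: sum_distrib_right mult.assoc intro!: sum.cong)
    also have "\<dots> = (\<Sum>y\<in>carrier G. f y * (\<Sum>x\<in>carrier G. g x * \<chi> (y \<otimes> x)))"
    proof (rule sum.cong[OF refl], rule arg_cong2[where f="(*)", OF refl])
      fix y assume y: "y \<in> carrier G"
      show "(\<Sum>x\<in>carrier G. g (inv y \<otimes> x) * \<chi> x) = (\<Sum>x\<in>carrier G. g x * \<chi> (y \<otimes> x))"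
        by (rule sum.reindex_bij_witness[of _ "\<lambda>x. y \<otimes> x" "\<lambda>x. inv y \<otimes> x"])
          (use y in \<open>auto simp: m_assoc[symmetric]\<close>)
    qed
    also have "\<dots> = X f * X g"
      unfolding X_def sum_product by (intro sum.cong refl) (simp add: mult sum_distrib_left mult_ac)
    finally show ?thesis .
  qed
  have X_set: "X (ga_set G (D l)) = (\<Sum>x\<in>D l. \<chi> x)" if "l \<in> {1..m}" for l
  proof -
    have "X (ga_set G (D l)) = (\<Sum>x\<in>carrier G. if x \<in> D l then \<chi> x else 0)"
      unfolding X_def ga_set_eq[OF D[OF that] finD[OF that]] by (intro sum.cong) auto
    then show ?thesis
      using D[OF that] fin by (simp add: sum.If_cases inf.absorb2 Int_commute flip: Int_def)
  qed
  have X_inv: "X (ga_set_inv G (D l)) = cnj (\<Sum>x\<in>D l. \<chi> x)" if "l \<in> {1..m}" for l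
  proof -
    have "ga_set_inv G (D l) = (\<lambda>x. \<Sum>g\<in>D l. ga_basis (inv g) x)"
      unfolding ga_set_inv_def using D[OF that]
      by (intro group_algebra_finsum) (auto simp: group_algebra_simps ga_basis_def)
    then have "X (ga_set_inv G (D l)) = (\<Sum>g\<in>D l. \<Sum>x\<in>carrier G. if x = inv g then \<chi> x else 0)"
      unfolding X_def by (subst sum.swap) (auto simp: ga_basis_def sum_distrib_right intro!: sum.cong)
    also have "\<dots> = (\<Sum>g\<in>D l. cnj (\<chi> g))"
      using D[OF that] fin by (intro sum.cong) (auto simp: inv)
    finally show ?thesis by simp
  qed
  have "(\<Oplus>\<^bsub>group_algebra G\<^esub> l \<in> {1..m} - {j}. ga_set G (D j) \<otimes>\<^bsub>group_algebra G\<^esub> ga_set_inv G (D l))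
      = of_nat lam \<odot>\<^bsub>group_algebra G\<^esub> (ga_set G (carrier G) \<ominus>\<^bsub>group_algebra G\<^esub> \<one>\<^bsub>group_algebra G\<^esub>)"
    using assms(1) j unfolding SEDF_def by blast
  also have "(\<Oplus>\<^bsub>group_algebra G\<^esub> l \<in> {1..m} - {j}. ga_set G (D j) \<otimes>\<^bsub>group_algebra G\<^esub> ga_set_inv G (D l))
      = (\<lambda>x. \<Sum>l\<in>{1..m} - {j}. (ga_set G (D j) \<otimes>\<^bsub>group_algebra G\<^esub> ga_set_inv G (D l)) x)"
    by (rule group_algebra_finsum) (auto simp: group_algebra_simps)
  also have "of_nat lam \<odot>\<^bsub>group_algebra G\<^esub> (ga_set G (carrier G) \<ominus>\<^bsub>group_algebra G\<^esub> \<one>\<^bsub>group_algebra G\<^esub>)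
      = (\<lambda>x. of_nat lam * ((if x \<in> carrier G then 1 else 0) - (if x = \<one> then 1 else 0)))"
    using fin by (subst group_algebra_minus)
      (auto simp: group_algebra_simps ga_basis_def ga_set_eq)
  finally have "X (\<lambda>x. \<Sum>l\<in>{1..m} - {j}. (ga_set G (D j) \<otimes>\<^bsub>group_algebra G\<^esub> ga_set_inv G (D l)) x)
      = X (\<lambda>x. of_nat lam * ((if x \<in> carrier G then 1 else 0) - (if x = \<one> then 1 else 0)))"
    by simp
  also have "X (\<lambda>x. \<Sum>l\<in>{1..m} - {j}. (ga_set G (D j) \<otimes>\<^bsub>group_algebra G\<^esub> ga_set_inv G (D l)) x)
      = (\<Sum>l\<in>{1..m} - {j}. X (ga_set G (D j) \<otimes>\<^bsub>group_algebra G\<^esub> ga_set_inv G (D l)))"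
    unfolding X_def sum_distrib_right by (rule sum.swap)
  also have "\<dots> = (\<Sum>x\<in>D j. \<chi> x) * cnj (\<Sum>l\<in>{1..m} - {j}. \<Sum>x\<in>D l. \<chi> x)"
    using j by (simp add: X_mult X_set X_inv sum_distrib_left)
  also have "X (\<lambda>x. of_nat lam * ((if x \<in> carrier G then 1 else 0) - (if x = \<one> then 1 else 0)))
      = of_nat lam * ((\<Sum>x\<in>carrier G. \<chi> x) - (\<Sum>x\<in>carrier G. if x = \<one> then \<chi> x else 0))"
    unfolding X_def sum_distrib_left sum_subtractf[symmetric] by (intro sum.cong) auto
  also have "\<dots> = - of_nat lam"
    using fin nontrivial by (simp add: one)
  finally show ?thesis .
qed

text \<open>With \<open>A\<close> the total, \<open>a j * cnj A\<close> equals the squared modulus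
  of \<open>a j\<close> minus \<open>lam\<close>. It is real, so \<open>a j\<close> is a real
  multiple of \<open>A\<close>, and the ratio satisfies a quadratic equation that does not depend on
  \<open>j\<close>. It remains to count how often each root occurs.\<close>

lemma linear_relation_of_character_values:
  fixes a :: "'i \<Rightarrow> complex" and lam :: real
  assumes fin: "finite J" and m: "card J = m" "m > 2" and lam: "lam > 0"
    and eq: "\<And>j. j \<in> J \<Longrightarrow> a j * cnj (\<Sum>l\<in>J - {j}. a l) = - of_real lam"
    and nz: "(\<Sum>j\<in>J. a j) \<noteq> 0"
  obtains b i j where "2 \<le> b" "2 * b < m" "i \<in> J" "j \<in> J"
    "of_nat (b - 1) * a i + of_nat (m - 1 - b) * a j = 0"
proof -
  define A where "A = (\<Sum>j\<in>J. a j)"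
  define s where "s = lam / (cmod A)\<^sup>2"
  \<comment> \<open>The square root of the discriminant of \<open>x^2 - x - s\<close>; the two
    possible ratios are \<open>(1 + \<beta>) / 2\<close> and
    \<open>(1 - \<beta>) / 2\<close>.\<close>
  define \<beta> where "\<beta> = sqrt (1 + 4 * s)"
  define \<alpha> where "\<alpha> j = ((cmod (a j))\<^sup>2 - lam) / (cmod A)\<^sup>2" for j
  define P where "P = {j \<in> J. \<alpha> j = (1 + \<beta>) / 2}"
  define b where "b = card P"
  have A: "A \<noteq> 0" using nz by (simp add: A_def)
  have s: "s > 0" using lam A by (simp add: s_def)
  have \<beta>: "\<beta> > 1" "\<beta>\<^sup>2 = 1 + 4 * s" using s by (auto simp: \<beta>_def)
  have a: "a j = of_real (\<alpha> j) * A" if "j \<in> J" for j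
  proof -
    have "(\<Sum>l\<in>J - {j}. a l) = A - a j"
      using fin that by (simp add: A_def sum_diff1)
    then have "a j * cnj A = a j * cnj (a j) - of_real lam"
      using eq[OF that] by (simp only: complex_cnj_diff) (simp add: algebra_simps)
    then have "a j * cnj A = of_real ((cmod (a j))\<^sup>2 - lam)"
      by (simp flip: complex_norm_square)
    then have "a j * (A * cnj A) = of_real ((cmod (a j))\<^sup>2 - lam) * A"
      by (simp add: mult_ac)
    then show ?thesis
      using A by (simp add: \<alpha>_def field_simps flip: complex_norm_square)
  qed
  have \<alpha>: "\<alpha> j = (1 + \<beta>) / 2 \<or> \<alpha> j = (1 - \<beta>) / 2" if "j \<in> J" for j
  proof -
    have "(cmod (a j))\<^sup>2 = (\<alpha> j)\<^sup>2 * (cmod A)\<^sup>2"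
      by (simp add: a[OF that] norm_mult power_mult_distrib)
    moreover have "\<alpha> j * (cmod A)\<^sup>2 = (cmod (a j))\<^sup>2 - lam"
      using A by (simp add: \<alpha>_def)
    moreover have "s * (cmod A)\<^sup>2 = lam"
      using A by (simp add: s_def)
    ultimately have "\<alpha> j * (cmod A)\<^sup>2 = ((\<alpha> j)\<^sup>2 - s) * (cmod A)\<^sup>2"
      by (simp add: left_diff_distrib)
    then have "\<alpha> j = (\<alpha> j)\<^sup>2 - s" using A by simp
    then have "(2 * \<alpha> j - 1)\<^sup>2 = \<beta>\<^sup>2"
      unfolding \<beta>(2) by (simp add: power2_eq_square algebra_simps)
    then have "2 * \<alpha> j - 1 = \<beta> \<or> 2 * \<alpha> j - 1 = - \<beta>" by (simp add: power2_eq_iff)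
    then show ?thesis by auto
  qed
  have PJ: "P \<subseteq> J" "finite P" using fin by (auto simp: P_def)
  have b_le: "b \<le> m" using card_mono[OF fin PJ(1)] m by (simp add: b_def)
  have card_compl: "card (J - P) = m - b" using card_Diff_subset[OF PJ(2,1)] m by (simp add: b_def)
  have "A = of_real (\<Sum>j\<in>J. \<alpha> j) * A"
    unfolding of_real_sum sum_distrib_right by (simp add: a A_def)
  then have "1 = (\<Sum>j\<in>J. \<alpha> j)" using A by (metis mult_cancel_right1 of_real_eq_1_iff)
  also have "\<dots> = (\<Sum>j\<in>P. \<alpha> j) + (\<Sum>j\<in>J - P. \<alpha> j)"
    using sum.subset_diff[OF PJ(1) fin, of \<alpha>] by simp
  also have "(\<Sum>j\<in>P. \<alpha> j) = (\<Sum>j\<in>P. (1 + \<beta>) / 2)"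
    by (intro sum.cong) (auto simp: P_def)
  also have "\<dots> = real b * ((1 + \<beta>) / 2)"
    by (simp add: b_def)
  also have "(\<Sum>j\<in>J - P. \<alpha> j) = (\<Sum>j\<in>J - P. (1 - \<beta>) / 2)"
    using \<alpha> by (intro sum.cong) (auto simp: P_def)
  also have "\<dots> = (real m - real b) * ((1 - \<beta>) / 2)"
    using b_le by (simp add: card_compl of_nat_diff)
  finally have key: "(real m - 2 * real b) * \<beta> = real m - 2"
    by (simp add: field_simps)
  \<comment> \<open>Both bounds on \<open>b\<close> come from \<open>key\<close>:
    \<open>m > 2\<close> and \<open>\<beta> > 0\<close> make the left factor positive, and then
    \<open>\<beta> > 1\<close> gives \<open>m - 2 * b < m - 2\<close>.\<close>
  have "real m - 2 * real b > 0"
  proof (rule ccontr)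
    assume "\<not> ?thesis"
    then have "(real m - 2 * real b) * \<beta> \<le> 0"
      using \<beta>(1) by (intro mult_nonpos_nonneg) auto
    then show False using key m(2) by simp
  qed
  then have lt: "2 * b < m" by linarith
  have "real m - 2 * real b < (real m - 2 * real b) * \<beta>"
    using \<open>real m - 2 * real b > 0\<close> \<beta>(1) by simp
  then have ge: "2 \<le> b" using key by linarith
  have "P \<noteq> {}" using ge by (auto simp: b_def)
  then obtain i where i: "i \<in> P" by blast
  have "card (J - P) \<noteq> 0" using lt card_compl by simp
  then have "J - P \<noteq> {}" by (intro notI) simp
  then obtain j where j: "j \<in> J - P" by blast
  have "i \<in> J" "\<alpha> i = (1 + \<beta>) / 2" using i by (simp_all add: P_def)
  then have i': "a i = of_real ((1 + \<beta>) / 2) * A" using a by metis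
  have "j \<in> J" "\<alpha> j = (1 - \<beta>) / 2" using j \<alpha> by (auto simp: P_def)
  then have j': "a j = of_real ((1 - \<beta>) / 2) * A" using a by metis
  \<comment> \<open>The two ratios sum to 1, so \<open>a i + a j = A\<close>. Removing one value of
    each kind from the total \<open>A\<close> thus leaves 0, which explains the weights
    \<open>b - 1\<close> and \<open>m - 1 - b\<close>.\<close>
  have "of_nat (b - 1) * a i + of_nat (m - 1 - b) * a j
      = of_real ((real b - 1) * ((1 + \<beta>) / 2) + (real m - 1 - real b) * ((1 - \<beta>) / 2)) * A"
    using ge lt by (simp add: i' j' of_nat_diff algebra_simps)
  also have "(real b - 1) * ((1 + \<beta>) / 2) + (real m - 1 - real b) * ((1 - \<beta>) / 2)
      = (real m - 2 - (real m - 2 * real b) * \<beta>) / 2"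
    by (simp add: field_simps)
  also have "\<dots> = 0" by (simp add: key)
  finally have "of_nat (b - 1) * a i + of_nat (m - 1 - b) * a j = 0" by simp
  then show thesis using that ge lt i j PJ by blast
qed

section \<open>Families in cyclic groups\<close>

lemma SEDF_group:
  assumes "SEDF G v m k lam D"
  shows "comm_group G" "finite (carrier G)" "Coset.order G = v" "v > 0" "lam > 0"
  using assms unfolding SEDF_def Coset.order_def by blast+

lemma SEDF_block:
  assumes "SEDF G v m k lam D" "l \<in> {1..m}"
  shows "D l \<subseteq> carrier G" "card (D l) = k"
  using assms unfolding SEDF_def by blast+

text \<open>Disjointness gives \<open>k * m \<le> v\<close>. In case of equality \<open>k\<close> is
  coprime to \<open>v - 1\<close>, so the parameter equation makes \<open>v - 1\<close> divide
  \<open>m - 1\<close>, contradicting \<open>v = k * m \<ge> 2 * m\<close>.\<close>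

lemma SEDF_card_union_less:
  assumes "SEDF G v m k lam D" "k > 1" "m > 2"
  shows "k * m < v"
proof -
  have v: "v > 0" and eq: "k\<^sup>2 * (m - 1) = lam * (v - 1)" and fin: "finite (carrier G)"
    and card: "card (carrier G) = v" and D: "\<And>j. j \<in> {1..m} \<Longrightarrow> D j \<subseteq> carrier G \<and> card (D j) = k"
    and disj: "disjoint_family_on D {1..m}"
    using assms(1) unfolding SEDF_def by blast+
  have finD: "finite (D j)" if "j \<in> {1..m}" for j
    using D[OF that] fin by (blast intro: finite_subset)
  have "card (\<Union>j\<in>{1..m}. D j) = (\<Sum>j\<in>{1..m}. card (D j))"
    using finD disj by (intro card_UN_disjoint) (auto simp: disjoint_family_on_def)
  also have "\<dots> = k * m" using D by simp
  finally have union: "card (\<Union>j\<in>{1..m}. D j) = k * m" .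
  have "(\<Union>j\<in>{1..m}. D j) \<subseteq> carrier G" using D by blast
  then have "k * m \<le> v"
    using card_mono[OF fin] union card by metis
  moreover have "k * m \<noteq> v"
  proof
    assume km: "k * m = v"
    have "coprime k (v - 1)"
    proof (rule coprimeI)
      fix d assume "d dvd k" "d dvd v - 1"
      then have "d dvd v" "d dvd v - 1" by (auto simp flip: km)
      then have "d dvd v - (v - 1)" by (rule dvd_diff_nat)
      then show "d dvd 1" using v by simp
    qed
    then have "coprime (k\<^sup>2) (v - 1)" by simp
    moreover have "v - 1 dvd k\<^sup>2 * (m - 1)" unfolding eq by simp
    ultimately have "v - 1 dvd m - 1" by (simp add: coprime_dvd_mult_right_iff coprime_commute)
    then have "v \<le> m" using assms(3) by (auto dest: dvd_imp_le)
    moreover have "m * 2 \<le> v" using assms(2) by (simp flip: km)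
    ultimately show False using assms(3) by simp
  qed
  ultimately show ?thesis by simp
qed

text \<open>As \<open>r\<close> divides \<open>k\<close> and is coprime to \<open>v - 1\<close>, the
  parameter equation gives \<open>r^2\<close> dividing \<open>lam\<close>. Multiplying that equation
  by \<open>m^2\<close> and using \<open>k * m < v\<close> yields
  \<open>m^2 * (v - 1) \<le> s^2 * (m - 1)\<close>, hence \<open>5 * (v - 1) \<le> s^2\<close>. The
  names \<open>r\<close> and \<open>s\<close> let the bound serve both primes.\<close>

lemma SEDF_size_bound:
  fixes r s :: nat
  assumes "prime r" "s > 1" and S: "SEDF G (r * s) m k lam D" and "k > 1" "m \<ge> 5" "r dvd k"
  shows "real r / real s \<le> real (r * s) / (5 * (real (r * s) - 1))"
proof -
  define v where "v = r * s"
  have eq: "k\<^sup>2 * (m - 1) = lam * (v - 1)" and pos: "lam > 0" "v > 0"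
    using S unfolding SEDF_def v_def by blast+
  have r: "r > 1" using assms(1) prime_gt_1_nat by blast
  have v1: "v > 1" using less_1_mult[OF r \<open>s > 1\<close>] by (simp add: v_def)
  have "coprime r (v - 1)"
  proof (rule coprimeI)
    fix d assume "d dvd r" "d dvd v - 1"
    then have "d dvd v" "d dvd v - 1" by (auto simp: v_def)
    then have "d dvd v - (v - 1)" by (rule dvd_diff_nat)
    then show "d dvd 1" using pos by simp
  qed
  then have "coprime (r\<^sup>2) (v - 1)" by simp
  moreover have "r\<^sup>2 dvd lam * (v - 1)"
    unfolding eq[symmetric] using \<open>r dvd k\<close> by (simp add: dvd_power_same)
  ultimately have "r\<^sup>2 dvd lam" by (simp add: coprime_dvd_mult_left_iff)
  then have lam: "r\<^sup>2 \<le> lam" using pos by (simp add: dvd_imp_le)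
  have "k * m < v" using SEDF_card_union_less[OF S \<open>k > 1\<close>] \<open>m \<ge> 5\<close> by (simp add: v_def)
  then have km: "(k * m)\<^sup>2 \<le> v\<^sup>2" by (simp add: power_mono)
  have "r\<^sup>2 * (m\<^sup>2 * (v - 1)) \<le> lam * (m\<^sup>2 * (v - 1))" using lam by simp
  also have "\<dots> = m\<^sup>2 * (lam * (v - 1))" by (simp only: mult.left_commute)
  also have "\<dots> = (k * m)\<^sup>2 * (m - 1)"
    unfolding eq[symmetric] by (simp only: power_mult_distrib mult_ac)
  also have "\<dots> \<le> v\<^sup>2 * (m - 1)" using km by simp
  also have "\<dots> = r\<^sup>2 * (s\<^sup>2 * (m - 1))" by (simp add: v_def power_mult_distrib)
  finally have "m\<^sup>2 * (v - 1) \<le> s\<^sup>2 * (m - 1)" using r by simp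
  \<comment> \<open>Multiply \<open>5 \<le> m\<close> by \<open>m - 1 \<le> m\<close>; this is where
    the constant 5 of the bound enters.\<close>
  moreover have "5 * (m - 1) \<le> m\<^sup>2"
    using \<open>m \<ge> 5\<close> unfolding power2_eq_square by (intro mult_mono) auto
  then have "5 * (m - 1) * (v - 1) \<le> m\<^sup>2 * (v - 1)" by (rule mult_le_mono1)
  ultimately have "5 * (m - 1) * (v - 1) \<le> s\<^sup>2 * (m - 1)" by (rule le_trans[rotated])
  then have "(m - 1) * (5 * (v - 1)) \<le> (m - 1) * s\<^sup>2" by (simp only: mult_ac)
  then have "5 * (v - 1) \<le> s\<^sup>2" using \<open>m \<ge> 5\<close> by simp
  then have "real (5 * (v - 1)) \<le> real (s\<^sup>2)" by (simp only: of_nat_le_iff)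
  then have "5 * (real v - 1) \<le> (real s)\<^sup>2" using v1 by (simp add: of_nat_diff)
  then have "real r * (5 * (real v - 1)) \<le> real r * (real s)\<^sup>2"
    by (intro mult_left_mono) auto
  also have "\<dots> = real v * real s" by (simp add: v_def power2_eq_square)
  finally have "real r * (5 * (real v - 1)) \<le> real v * real s" .
  then have "real r / real s \<le> real v / (5 * (real v - 1))"
    using v1 \<open>s > 1\<close> by (simp add: divide_le_eq le_divide_eq mult.commute)
  then show ?thesis by (simp only: v_def)
qed

section \<open>Character sums with respect to a fixed generator\<close>

context
  fixes G :: "('a, 'b) monoid_scheme" (structure) and D :: "nat \<Rightarrow> 'a set"
    and v m k lam :: nat and a :: 'a
  assumes S: "SEDF G v m k lam D" and k: "k > 1" and m: "m > 2"
    and a: "a \<in> carrier G" "group.ord G a = v"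
begin

text \<open>The value on \<open>D\<^sub>l\<close> of the character with \<open>\<chi> a = \<omega>\<close>.\<close>

definition chi_sum :: "complex \<Rightarrow> nat \<Rightarrow> complex" where
  "chi_sum \<omega> l = (\<Sum>i<v. of_bool (a [^] i \<in> D l) * \<omega> ^ i)"

lemma SEDF_cyclic_bij: "bij_betw (\<lambda>i::nat. a [^] i) {..<v} (carrier G)"
proof -
  interpret comm_group G by (rule SEDF_group[OF S])
  show ?thesis using bij_betw_nat_pow_ord[of a] SEDF_group(2,3)[OF S] a by simp
qed

lemma SEDF_cyclic_sum:
  fixes f :: "'a \<Rightarrow> 'c :: semiring_1"
  assumes "l \<in> {1..m}"
  shows "(\<Sum>x\<in>D l. f x) = (\<Sum>i<v. of_bool (a [^] i \<in> D l) * f (a [^] i))"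
proof -
  have "(\<Sum>x\<in>D l. f x) = (\<Sum>x\<in>carrier G. of_bool (x \<in> D l) * f x)"
    using SEDF_block(1)[OF S assms] SEDF_group(2)[OF S] by (intro sum.mono_neutral_cong_left) auto
  then show ?thesis by (simp add: sum.reindex_bij_betw[OF SEDF_cyclic_bij, symmetric])
qed

text \<open>This evaluates at 1 the polynomial whose value at \<open>\<omega>\<close> is
  \<open>chi_sum \<omega> l\<close>. The type is left general because the count is used both in the
  integers and in the naturals.\<close>

lemma SEDF_cyclic_card:
  assumes "l \<in> {1..m}"
  shows "(\<Sum>i<v. of_bool (a [^] i \<in> D l)) = (of_nat k :: 'c :: semiring_1)"
  using SEDF_cyclic_sum[OF assms, of "\<lambda>_. 1 :: 'c"] SEDF_block(2)[OF S assms] by simp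

text \<open>Every root \<open>\<omega>\<close> as assumed defines a character with values of modulus
  1, and it is nontrivial because the geometric sum of \<open>\<omega>\<close> vanishes.\<close>

lemma SEDF_cyclic_character:
  assumes "\<omega> ^ v = 1" "\<omega> \<noteq> 1" "j \<in> {1..m}"
  shows "chi_sum \<omega> j * cnj (\<Sum>l\<in>{1..m} - {j}. chi_sum \<omega> l) = - of_nat lam"
proof -
  interpret comm_group G by (rule SEDF_group[OF S])
  obtain \<chi> where mult: "\<And>x y. x \<in> carrier G \<Longrightarrow> y \<in> carrier G \<Longrightarrow> \<chi> (x \<otimes> y) = \<chi> x * \<chi> y"
    and \<chi>: "\<And>i::nat. \<chi> (a [^] i) = \<omega> ^ i"
    using cyclic_character[OF SEDF_group(2)[OF S] a(1), of \<omega>] a(2) SEDF_group(3)[OF S] assms(1) by metis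
  have "cmod \<omega> ^ v = 1 ^ v" using assms(1) by (simp flip: norm_power)
  then have norm\<omega>: "cmod \<omega> = 1"
    using power_eq_iff_eq_base[OF SEDF_group(4)[OF S], of "cmod \<omega>" 1] by simp
  have norm: "cmod (\<chi> x) = 1" if x: "x \<in> carrier G" for x
  proof -
    obtain i :: nat where "x = a [^] i" using SEDF_cyclic_bij x by (auto simp: bij_betw_def)
    then show ?thesis by (simp add: \<chi> norm_power norm\<omega>)
  qed
  have nontriv: "(\<Sum>x\<in>carrier G. \<chi> x) = 0"
    using geometric_sum_root_of_unity[OF assms(1,2)]
    by (simp add: sum.reindex_bij_betw[OF SEDF_cyclic_bij, symmetric] \<chi>)
  have "(\<Sum>x\<in>D l. \<chi> x) = chi_sum \<omega> l" if "l \<in> {1..m}" for l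
    unfolding SEDF_cyclic_sum[OF that] chi_sum_def by (simp add: \<chi>)
  then show ?thesis
    using SEDF_character_sum[OF S mult norm nontriv assms(3)] assms(3) by simp
qed

lemma SEDF_cyclic_linear_relation:
  assumes "\<omega> ^ v = 1" "\<omega> \<noteq> 1" "(\<Sum>l\<in>{1..m}. chi_sum \<omega> l) \<noteq> 0"
  obtains b i j where "2 \<le> b" "2 * b < m" "i \<in> {1..m}" "j \<in> {1..m}"
    "of_nat (b - 1) * chi_sum \<omega> i + of_nat (m - 1 - b) * chi_sum \<omega> j = 0"
proof -
  have card: "card {1..m} = m" by simp
  have lam: "real lam > 0" using SEDF_group(5)[OF S] by simp
  have eq: "chi_sum \<omega> j * cnj (\<Sum>l\<in>{1..m} - {j}. chi_sum \<omega> l) = - of_real (real lam)"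
    if "j \<in> {1..m}" for j
    using SEDF_cyclic_character[OF assms(1,2) that] by simp
  show thesis
    by (rule linear_relation_of_character_values[OF finite_atLeastAtMost card m lam eq assms(3)])
      (assumption, rule that)
qed

text \<open>Take \<open>\<omega>\<close> of order \<open>r\<close>. A vanishing integer combination
  of the values \<open>chi_sum \<omega> l\<close> is a polynomial relation for
  \<open>\<omega>\<close> whose value at 1 is \<open>k\<close> times the sum of the coefficients.
  That sum is \<open>m\<close> if the total vanishes, and \<open>m - 2\<close> for the two-term
  relation otherwise.\<close>

lemma SEDF_cyclic_prime_dvd:
  assumes "prime r" "r dvd v"
  shows "r dvd k * m \<or> r dvd k * (m - 2)"
proof -
  obtain \<omega> :: complex where \<omega>: "\<And>k. \<omega> ^ k = 1 \<longleftrightarrow> r dvd k"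
    using primitive_root_of_unity_exists[of r] assms(1) prime_gt_0_nat by blast
  have \<omega>_r: "\<omega> ^ r = 1" "\<omega> \<noteq> 1" "\<omega> ^ v = 1"
    using \<omega>[of r] \<omega>[of 1] \<omega>[of v] assms(2) prime_gt_1_nat[OF assms(1)] by simp_all
  have dvd: "int r dvd (\<Sum>l\<in>{1..m}. c l) * int k" if "(\<Sum>l\<in>{1..m}. of_int (c l) * chi_sum \<omega> l) = 0" for c
  proof -
    have "(\<Sum>i<v. of_int (\<Sum>l\<in>{1..m}. c l * of_bool (a [^] i \<in> D l)) * \<omega> ^ i)
        = (\<Sum>l\<in>{1..m}. of_int (c l) * chi_sum \<omega> l)"
      unfolding chi_sum_def sum_distrib_left of_int_sum sum_distrib_right
      by (subst sum.swap) (simp add: mult.assoc)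
    then have "int r dvd (\<Sum>i<v. \<Sum>l\<in>{1..m}. c l * of_bool (a [^] i \<in> D l))"
      using prime_dvd_sum_if_root_of_unity_sum_eq_0[OF assms(1) \<omega>_r(1,2),
          of "\<lambda>i. \<Sum>l\<in>{1..m}. c l * of_bool (a [^] i \<in> D l)" "\<lambda>i. i" "{..<v}"] that
      by (simp only:)
    also have "(\<Sum>i<v. \<Sum>l\<in>{1..m}. c l * of_bool (a [^] i \<in> D l))
        = (\<Sum>l\<in>{1..m}. c l * (\<Sum>i<v. of_bool (a [^] i \<in> D l)))"
      unfolding sum_distrib_left by (rule sum.swap)
    also have "\<dots> = (\<Sum>l\<in>{1..m}. c l * int k)"
      by (intro sum.cong refl) (simp only: SEDF_cyclic_card of_nat_id)
    finally show ?thesis by (simp add: sum_distrib_right)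
  qed
  show ?thesis
  proof (cases "(\<Sum>l\<in>{1..m}. chi_sum \<omega> l) = 0")
    case True
    then have "int r dvd int (k * m)" using dvd[of "\<lambda>_. 1"] by (simp add: mult.commute)
    then show ?thesis unfolding of_nat_dvd_iff by blast
  next
    case False
    then obtain b i j where b: "2 \<le> b" "2 * b < m" and ij: "i \<in> {1..m}" "j \<in> {1..m}"
      and rel: "of_nat (b - 1) * chi_sum \<omega> i + of_nat (m - 1 - b) * chi_sum \<omega> j = 0"
      using SEDF_cyclic_linear_relation[OF \<omega>_r(3,2)] by blast
    \<comment> \<open>Adding two separate indicators keeps both sums correct without a proof that
      \<open>i\<close> and \<open>j\<close> differ.\<close>
    define c where "c l = (if l = i then int (b - 1) else 0) + (if l = j then int (m - 1 - b) else 0)" for l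
    have "of_int (c l) * chi_sum \<omega> l = (if l = i then of_nat (b - 1) * chi_sum \<omega> i else 0)
        + (if l = j then of_nat (m - 1 - b) * chi_sum \<omega> j else 0)" for l
      by (simp add: c_def algebra_simps)
    then have "(\<Sum>l\<in>{1..m}. of_int (c l) * chi_sum \<omega> l) = 0"
      using ij rel by (simp only: sum.distrib sum.delta finite_atLeastAtMost if_True)
    moreover have "(\<Sum>l\<in>{1..m}. c l) = int (m - 2)"
    proof -
      have "(\<Sum>l\<in>{1..m}. c l) = int (b - 1) + int (m - 1 - b)"
        unfolding c_def using ij by (simp only: sum.distrib sum.delta finite_atLeastAtMost if_True)
      then show ?thesis using b by linarith
    qed
    ultimately have "int r dvd int (k * (m - 2))"
      using dvd[of c] by (simp only: of_nat_mult mult.commute[of "int k"])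
    then show ?thesis unfolding of_nat_dvd_iff by blast
  qed
qed

text \<open>If the total vanished at every nontrivial character, the multiplicity function
  \<open>f\<close> of the blocks would be constant, so \<open>v\<close> would divide
  \<open>k * m\<close>, which lies strictly between 0 and \<open>v\<close>. Hence the linear
  relation is available for some character, and its bounds \<open>2 \<le> b\<close> and
  \<open>2 * b < m\<close> force \<open>m \<ge> 5\<close>.\<close>

lemma SEDF_cyclic_five_le: "m \<ge> 5"
proof -
  obtain \<zeta> :: complex where \<zeta>: "\<And>k. \<zeta> ^ k = 1 \<longleftrightarrow> v dvd k"
    using primitive_root_of_unity_exists[OF SEDF_group(4)[OF S]] by blast
  define f :: "nat \<Rightarrow> nat" where "f i = (\<Sum>l\<in>{1..m}. of_bool (a [^] i \<in> D l))" for i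
  have swap: "(\<Sum>i<v. of_nat (f i) * \<omega> ^ i) = (\<Sum>l\<in>{1..m}. chi_sum \<omega> l)" for \<omega>
    unfolding f_def chi_sum_def of_nat_sum sum_distrib_right by (subst sum.swap) simp
  have "\<exists>t\<in>{1..<v}. (\<Sum>l\<in>{1..m}. chi_sum (\<zeta> ^ t) l) \<noteq> 0"
  proof (rule ccontr)
    assume "\<not> ?thesis"
    then have vanish: "(\<Sum>i<v. of_nat (f i) * (\<zeta> ^ t) ^ i) = 0" if "t \<in> {1..<v}" for t
      using that by (simp only: swap) blast
    have "of_nat (v * f 0) = (of_nat (\<Sum>i<v. f i) :: complex)"
      using constant_if_fourier_coefficients_vanish[of \<zeta> v "\<lambda>i. of_nat (f i)", OF \<zeta> vanish SEDF_group(4)[OF S]] by simp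
    then have "v * f 0 = (\<Sum>i<v. f i)" by (simp only: of_nat_eq_iff)
    also have "\<dots> = (\<Sum>l\<in>{1..m}. \<Sum>i<v. of_bool (a [^] i \<in> D l))"
      unfolding f_def by (rule sum.swap)
    also have "\<dots> = (\<Sum>l\<in>{1..m}. k)"
      by (intro sum.cong refl) (simp only: SEDF_cyclic_card of_nat_id)
    also have "\<dots> = k * m" by simp
    finally have "v dvd k * m" by (metis dvd_triv_left)
    then show False using SEDF_card_union_less[OF S k m] k m by (auto dest: dvd_imp_le)
  qed
  then obtain t where t: "t \<in> {1..<v}" "(\<Sum>l\<in>{1..m}. chi_sum (\<zeta> ^ t) l) \<noteq> 0" by blast
  have "(\<zeta> ^ t) ^ v = 1" using \<zeta>[of "t * v"] by (simp add: power_mult)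
  moreover have "\<zeta> ^ t \<noteq> 1" using \<zeta>[of t] t(1) by (auto dest: dvd_imp_le)
  ultimately obtain b where "2 \<le> b" "2 * b < m"
    using SEDF_cyclic_linear_relation[OF _ _ t(2)] by blast
  then show ?thesis by simp
qed

end

theorem mainTheorem4:
  fixes G :: "('a, 'b) monoid_scheme" and D :: "nat \<Rightarrow> 'a set"
    and p q v m k lam :: nat
  assumes "prime p" and "prime q" and "p \<noteq> q" and "v = p * q"
    and "SEDF G v m k lam D" and "k > 1" and "m > 2"
  shows "(k\<^sup>2 * (m - 1) = lam * (v - 1) \<and> k * m < v) \<and>
    ([k * (m - 2) = 0] (mod p) \<or> [k * (m - 2) = 0] (mod q)) \<and>
    (p dvd k \<longrightarrow>
       real p / real q \<le> real v / (5 * (real v - 1)) \<and>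
       real v / (5 * (real v - 1)) = 1 / 5 + 1 / (5 * (real v - 1))) \<and>
    (q dvd k \<longrightarrow>
       real q / real p \<le> real v / (5 * (real v - 1)) \<and>
       real v / (5 * (real v - 1)) = 1 / 5 + 1 / (5 * (real v - 1)))"
proof -
  note S = assms(5)
  interpret comm_group G by (rule SEDF_group[OF S])
  have pq: "p > 1" "q > 1" using assms(1,2) prime_gt_1_nat by blast+
  then have v: "v > 1" unfolding assms(4) by (rule less_1_mult)
  have "finite (carrier G)" "Coset.order G = p * q"
    using SEDF_group[OF S] assms(4) by simp_all
  then obtain a where a: "a \<in> carrier G" "ord a = v"
    using element_of_order_prime_mult[OF assms(1-3)] unfolding assms(4) by blast
  have km: "k * m < v" using SEDF_card_union_less[OF S assms(6,7)] .
  have m: "m \<ge> 5" using SEDF_cyclic_five_le[OF S assms(6,7) a] .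
  \<comment> \<open>Otherwise both primes divide \<open>k * m\<close>, and so does their product
    \<open>v\<close>, although \<open>0 < k * m < v\<close>.\<close>
  have "p dvd k * (m - 2) \<or> q dvd k * (m - 2)"
  proof (rule ccontr)
    assume "\<not> ?thesis"
    then have "p dvd k * m" "q dvd k * m"
      using SEDF_cyclic_prime_dvd[OF S assms(6,7) a assms(1)]
        SEDF_cyclic_prime_dvd[OF S assms(6,7) a assms(2)] assms(4) by auto
    then have "v dvd k * m"
      using primes_coprime[OF assms(1-3)] by (simp add: assms(4) divides_mult)
    then show False using km assms(6,7) by (auto dest: dvd_imp_le)
  qed
  moreover have "real p / real q \<le> real v / (5 * (real v - 1))" if "p dvd k"
    using SEDF_size_bound[OF assms(1) pq(2) S[unfolded assms(4)] assms(6) m that]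
    unfolding assms(4) .
  moreover have "real q / real p \<le> real v / (5 * (real v - 1))" if "q dvd k"
    using SEDF_size_bound[OF assms(2) pq(1) S[unfolded assms(4) mult.commute[of p]] assms(6) m that]
    unfolding assms(4) mult.commute[of p] .
  moreover have "real v / (5 * (real v - 1)) = 1 / 5 + 1 / (5 * (real v - 1))"
    using v by (simp add: field_simps)
  moreover have "k\<^sup>2 * (m - 1) = lam * (v - 1)" using S unfolding SEDF_def by blast
  ultimately show ?thesis using km by (simp add: cong_0_iff)
qed

end
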